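(* Let $X$ be a compact metric space and let $(X,F)$ be a uniformly stable dynamical system. Let $\gamma$ be a real-valued function on $X$, and put $s_n(x)=\sum_{k=0}^n\gamma(F^kx)$, $n\ge0$. The equation $$\varphi(Fx)-\varphi(x)=\gamma(x),\quad x\in X,$$ is solvable in $C(X)$ if and only if $\gamma\in C(X)$ and the subset $\{s_n:n\ge0\}\subset C(X)$ is bounded and equicontinuous.
   Context: $X$ is nonempty, and $C(X)$ is the space of continuous real-valued functions on $X$ with the sup-norm. For a metric space $X$ with distance $d$ and a map $F:X\to X$, the dynamical system $(X,F)$ is called uniformly stable if for every $\varepsilon>0$ there exists $\delta>0$ such that $d(x,y)<\delta$ implies $d(F^nx,F^ny)<\varepsilon$ for all $x,y\in X$ and all $n\in\mathbb{N}=\{0,1,2,\dots\}$. *)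

theory Defs
  imports "HOL-Analysis.Analysis"
begin

text \<open>
  The compact metric space X is a type of class \<^class>\<open>metric_space\<close> with compact
  universe. For such a type every continuous real function is bounded, so C(X) with the
  sup-norm is the library type of bounded continuous functions \<open>'a \<Rightarrow>\<^sub>C real\<close>, and
  \<open>f \<in> bcontfun\<close> says that a function \<open>f\<close> belongs to C(X).
\<close>

definition uniformly_stable :: "('a::metric_space \<Rightarrow> 'a) \<Rightarrow> bool" where
  "uniformly_stable F \<longleftrightarrow>
     (\<forall>\<epsilon>>0. \<exists>\<delta>>0. \<forall>x y. dist x y < \<delta> \<longrightarrow>
        (\<forall>n. dist ((F ^^ n) x) ((F ^^ n) y) < \<epsilon>))"

definition orbit_sum :: "('a \<Rightarrow> 'a) \<Rightarrow> ('a \<Rightarrow> real) \<Rightarrow> nat \<Rightarrow> 'a \<Rightarrow> real" where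
  "orbit_sum F \<gamma> n x = (\<Sum>k=0..n. \<gamma> ((F ^^ k) x))"

text \<open>
  The modulus \<open>\<delta>\<close> is uniform in the points as well as in the functions; on a compact
  space this is the same as equicontinuity at every point.
\<close>

definition equicontinuous :: "('a::metric_space \<Rightarrow> 'b::metric_space) set \<Rightarrow> bool" where
  "equicontinuous S \<longleftrightarrow>
     (\<forall>\<epsilon>>0. \<exists>\<delta>>0. \<forall>f\<in>S. \<forall>x y. dist x y < \<delta> \<longrightarrow> dist (f x) (f y) < \<epsilon>)"

text \<open>
  \<^const>\<open>Bcontfun\<close> is meaningful only on \<^const>\<open>bcontfun\<close>, hence the first conjunct.
\<close>

definition bounded_in_C :: "('a::metric_space \<Rightarrow> real) set \<Rightarrow> bool" where
  "bounded_in_C S \<longleftrightarrow> S \<subseteq> bcontfun \<and> bounded (Bcontfun ` S)"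

end

theory Submission
  imports Defs
begin

text \<open>
  If \<open>\<phi>\<close> solves \<open>\<phi> \<circ> F - \<phi> = \<gamma>\<close>, the orbit sums telescope to
  \<open>s\<^sub>n = \<phi> \<circ> F\<^sup>n\<^sup>+\<^sup>1 - \<phi>\<close>. They are therefore bounded by twice the norm of \<open>\<phi>\<close>. By compactness
  \<open>\<phi>\<close> is uniformly continuous, and uniform stability says that the iterates of \<open>F\<close> share one
  modulus of continuity; composing the two gives a common modulus for all \<open>s\<^sub>n\<close>
  (\<open>equicontinuous_orbit_sums_of_coboundary\<close>).

  Conversely, a solution can be written down pointwise, as
  \<open>\<phi> x = - limsup\<^sub>n s\<^sub>n x\<close>, which is finite because the orbit sums are bounded.
  Since \<open>s\<^sub>n\<^sub>+\<^sub>1 x = \<gamma> x + s\<^sub>n (F x)\<close>, and the upper limit ignores the shift of the index and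
  commutes with adding the constant \<open>\<gamma> x\<close>, this function satisfies the equation
  (\<open>real_limsup_orbit_sum_shift\<close>). It is continuous because an upper limit is monotone: if
  \<open>\<bar>s\<^sub>n x - s\<^sub>n y\<bar> \<le> \<epsilon>\<close> for every \<open>n\<close>, then the upper limits at \<open>x\<close> and \<open>y\<close> also differ by at
  most \<open>\<epsilon>\<close>, so \<open>\<phi>\<close> inherits the modulus of an equicontinuous family
  (\<open>continuous_real_limsup\<close>). Taking the upper limit at each point avoids choosing a uniformly
  convergent subsequence of averages by the Arzela-Ascoli theorem.
\<close>

text \<open>
  The upper limit is taken in the extended reals, where it always exists; the conversion back
  to a real number is faithful on bounded sequences, and an infinite value becomes 0.
\<close>

definition real_limsup :: "(nat \<Rightarrow> real) \<Rightarrow> real" where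
  "real_limsup a = real_of_ereal (limsup (\<lambda>n. ereal (a n)))"

lemma ereal_real_limsup:
  assumes "\<And>n. \<bar>a n\<bar> \<le> M"
  shows "ereal (real_limsup a) = limsup (\<lambda>n. ereal (a n))"
proof -
  have "limsup (\<lambda>n. ereal (a n)) \<le> ereal M"
    using assms by (intro Limsup_bounded always_eventually) (auto simp: abs_le_iff)
  moreover have "ereal (- M) \<le> liminf (\<lambda>n. ereal (a n))"
  proof (intro Liminf_bounded always_eventually allI)
    show "ereal (- M) \<le> ereal (a n)" for n
      using assms[of n] by simp
  qed
  then have "ereal (- M) \<le> limsup (\<lambda>n. ereal (a n))"
    by (rule order_trans) (simp add: Liminf_le_Limsup)
  ultimately show ?thesis
    unfolding real_limsup_def by (intro ereal_real') auto
qed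

text \<open>
  This one-sided estimate carries both halves of the construction. Used in both directions with
  a small \<open>c\<close> it compares the upper limits at nearby points; used with \<open>c\<close> and \<open>- c\<close> it says
  that the upper limit commutes with adding a constant.
\<close>
lemma real_limsup_le_add:
  assumes "\<And>n. \<bar>a n\<bar> \<le> M" "\<And>n. \<bar>b n\<bar> \<le> K" "\<And>n. a n \<le> b n + c"
  shows "real_limsup a \<le> real_limsup b + c"
proof -
  have "limsup (\<lambda>n. ereal (a n)) \<le> limsup (\<lambda>n. ereal (b n) + ereal c)"
    using assms(3) by (intro Limsup_mono always_eventually) auto
  also have "\<dots> = limsup (\<lambda>n. ereal (b n)) + ereal c"
    by (intro Limsup_add_ereal_right) auto
  finally show ?thesis
    using assms by (simp flip: ereal_real_limsup[of a M] ereal_real_limsup[of b K])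
qed

lemma real_limsup_Suc: "real_limsup (\<lambda>n. a (Suc n)) = real_limsup a"
  unfolding real_limsup_def using limsup_shift[of "\<lambda>n. ereal (a n)"] by simp

lemma orbit_sum_telescope:
  assumes "\<And>x. \<phi> (F x) - \<phi> x = \<gamma> x"
  shows "orbit_sum F \<gamma> n x = \<phi> ((F ^^ Suc n) x) - \<phi> x"
proof -
  have "orbit_sum F \<gamma> n x = (\<Sum>k=0..n. \<phi> ((F ^^ Suc k) x) - \<phi> ((F ^^ k) x))"
    by (simp add: orbit_sum_def flip: assms)
  also have "\<dots> = \<phi> ((F ^^ Suc n) x) - \<phi> ((F ^^ 0) x)"
    by (rule sum_Suc_diff) simp
  finally show ?thesis by simp
qed

lemma orbit_sum_Suc_shift: "orbit_sum F \<gamma> (Suc n) x = \<gamma> x + orbit_sum F \<gamma> n (F x)"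
  unfolding orbit_sum_def
  by (subst sum.atLeast0_atMost_Suc_shift) (simp add: funpow_swap1)

lemma uniformly_stable_continuous_iterate:
  assumes "uniformly_stable F"
  shows "continuous_on UNIV (F ^^ n)"
  unfolding continuous_on_iff
proof (intro ballI allI impI)
  fix x and e :: real assume "e > 0"
  with assms show "\<exists>d>0. \<forall>y\<in>UNIV. dist y x < d \<longrightarrow> dist ((F ^^ n) y) ((F ^^ n) x) < e"
    unfolding uniformly_stable_def by blast
qed

lemma bcontfun_if_compact_UNIV:
  fixes f :: "'a::metric_space \<Rightarrow> real"
  assumes "compact (UNIV :: 'a set)" "continuous_on UNIV f"
  shows "f \<in> bcontfun"
  using assms by (simp add: bcontfun_def compact_continuous_image compact_imp_bounded)

lemma bounded_in_C_iff:
  "bounded_in_C S \<longleftrightarrow> S \<subseteq> bcontfun \<and> (\<exists>M. \<forall>f\<in>S. \<forall>x. \<bar>f x\<bar> \<le> M)"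
proof (cases "S \<subseteq> bcontfun")
  case True
  have "(\<exists>M. \<forall>f\<in>S. norm (Bcontfun f) \<le> M) \<longleftrightarrow> (\<exists>M. \<forall>f\<in>S. \<forall>x. \<bar>f x\<bar> \<le> M)"
  proof (intro iffI; elim exE)
    fix M assume "\<forall>f\<in>S. norm (Bcontfun f) \<le> M"
    then have "\<bar>f x\<bar> \<le> M" if "f \<in> S" for f x
      using norm_bounded[of "Bcontfun f" x] True that
      by (auto simp: Bcontfun_inverse subset_iff intro: order_trans)
    then show "\<exists>M. \<forall>f\<in>S. \<forall>x. \<bar>f x\<bar> \<le> M" by blast
  next
    fix M assume "\<forall>f\<in>S. \<forall>x. \<bar>f x\<bar> \<le> M"
    then have "norm (Bcontfun f) \<le> M" if "f \<in> S" for f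
      using True that by (intro norm_bound) (auto simp: Bcontfun_inverse subset_iff)
    then show "\<exists>M. \<forall>f\<in>S. norm (Bcontfun f) \<le> M" by blast
  qed
  with True show ?thesis
    by (simp add: bounded_in_C_def bounded_iff)
qed (simp add: bounded_in_C_def)

text \<open>
  Only the two ends of the telescoped sum matter: uniform continuity of \<open>\<phi>\<close> turns
  \<open>\<epsilon> / 2\<close> into \<open>\<eta>\<close>, and stability turns \<open>\<eta>\<close> into a \<open>\<delta>\<close> that keeps the orbits of
  \<open>x\<close> and \<open>y\<close> within \<open>\<eta>\<close> of each other at all times.
\<close>
lemma equicontinuous_orbit_sums_of_coboundary:
  assumes stable: "uniformly_stable F" and unif: "uniformly_continuous_on UNIV \<phi>"
    and \<phi>: "\<And>x. \<phi> (F x) - \<phi> x = \<gamma> x"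
  shows "equicontinuous (range (orbit_sum F \<gamma>))"
  unfolding equicontinuous_def
proof (intro allI impI)
  fix \<epsilon> :: real assume "\<epsilon> > 0"
  then have "\<epsilon> / 2 > 0" by simp
  with unif obtain \<eta> where "\<eta> > 0"
    and \<eta>: "\<And>x y. dist x y < \<eta> \<Longrightarrow> dist (\<phi> x) (\<phi> y) < \<epsilon> / 2"
    unfolding uniformly_continuous_on_def by (metis UNIV_I)
  from stable \<open>\<eta> > 0\<close> obtain \<delta> where "\<delta> > 0"
    and \<delta>: "\<And>x y n. dist x y < \<delta> \<Longrightarrow> dist ((F ^^ n) x) ((F ^^ n) y) < \<eta>"
    unfolding uniformly_stable_def by blast
  have "dist (orbit_sum F \<gamma> n x) (orbit_sum F \<gamma> n y) < \<epsilon>" if "dist x y < \<delta>" for n x y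
    using \<eta>[OF \<delta>[OF that, of "Suc n"]] \<eta>[OF \<delta>[OF that, of 0]]
    unfolding orbit_sum_telescope[of \<phi> F \<gamma>, OF \<phi>] dist_real_def funpow_0 by linarith
  with \<open>\<delta> > 0\<close> show "\<exists>\<delta>>0. \<forall>f\<in>range (orbit_sum F \<gamma>). \<forall>x y. dist x y < \<delta> \<longrightarrow> dist (f x) (f y) < \<epsilon>"
    by blast
qed

text \<open>
  The sums along the orbits of \<open>x\<close> and of \<open>F x\<close> differ by the constant \<open>\<gamma> x\<close> once the index
  is shifted by one, and the upper limit does not see the shift. This is the cohomological
  equation for the negative of the upper limit.
\<close>
lemma real_limsup_orbit_sum_shift:
  assumes M: "\<And>n x. \<bar>orbit_sum F \<gamma> n x\<bar> \<le> M"
  shows "real_limsup (\<lambda>n. orbit_sum F \<gamma> n x) = \<gamma> x + real_limsup (\<lambda>n. orbit_sum F \<gamma> n (F x))"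
proof (rule antisym)
  let ?s = "orbit_sum F \<gamma>"
  have "real_limsup (\<lambda>n. ?s (Suc n) x) \<le> real_limsup (\<lambda>n. ?s n (F x)) + \<gamma> x"
    by (rule real_limsup_le_add[OF M M]) (simp add: orbit_sum_Suc_shift)
  then show "real_limsup (\<lambda>n. ?s n x) \<le> \<gamma> x + real_limsup (\<lambda>n. ?s n (F x))"
    by (simp add: real_limsup_Suc[of "\<lambda>n. ?s n x"])
  have "real_limsup (\<lambda>n. ?s n (F x)) \<le> real_limsup (\<lambda>n. ?s (Suc n) x) + - \<gamma> x"
    by (rule real_limsup_le_add[OF M M]) (simp add: orbit_sum_Suc_shift)
  then show "\<gamma> x + real_limsup (\<lambda>n. ?s n (F x)) \<le> real_limsup (\<lambda>n. ?s n x)"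
    by (simp add: real_limsup_Suc[of "\<lambda>n. ?s n x"])
qed

text \<open>
  A pointwise upper limit of continuous functions need not be continuous; a modulus of
  continuity common to all of them passes to the upper limit by monotonicity.
\<close>
lemma continuous_real_limsup:
  fixes s :: "nat \<Rightarrow> 'a::metric_space \<Rightarrow> real"
  assumes M: "\<And>n x. \<bar>s n x\<bar> \<le> M" and eq: "equicontinuous (range s)"
  shows "continuous_on UNIV (\<lambda>x. real_limsup (\<lambda>n. s n x))"
  unfolding continuous_on_iff
proof (intro ballI allI impI)
  fix x and e :: real assume "e > 0"
  then have "e / 2 > 0" by simp
  with eq obtain d where "d > 0"
    and d: "\<And>n y z. dist y z < d \<Longrightarrow> dist (s n y) (s n z) < e / 2"
    unfolding equicontinuous_def by (metis rangeI)
  have le: "real_limsup (\<lambda>n. s n y) \<le> real_limsup (\<lambda>n. s n z) + e / 2" if "dist y z < d" for y z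
  proof (rule real_limsup_le_add[OF M M])
    show "s n y \<le> s n z + e / 2" for n
      using d[OF that, of n] unfolding dist_real_def by linarith
  qed
  have "dist (real_limsup (\<lambda>n. s n y)) (real_limsup (\<lambda>n. s n x)) < e" if "dist y x < d" for y
    using le[of y x] le[of x y] that \<open>e > 0\<close> unfolding dist_real_def dist_commute[of x y]
    by linarith
  with \<open>d > 0\<close> show "\<exists>d>0. \<forall>y\<in>UNIV. dist y x < d \<longrightarrow>
      dist (real_limsup (\<lambda>n. s n y)) (real_limsup (\<lambda>n. s n x)) < e"
    by blast
qed

theorem theorem8p6:
  fixes F :: "'a::metric_space \<Rightarrow> 'a" and \<gamma> :: "'a \<Rightarrow> real"
  assumes "compact (UNIV :: 'a set)"
    and "uniformly_stable F"
  shows "(\<exists>\<phi> :: 'a \<Rightarrow>\<^sub>C real. \<forall>x. apply_bcontfun \<phi> (F x) - apply_bcontfun \<phi> x = \<gamma> x) \<longleftrightarrow>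
         \<gamma> \<in> bcontfun \<and>
         bounded_in_C (range (orbit_sum F \<gamma>)) \<and>
         equicontinuous (range (orbit_sum F \<gamma>))"
proof (intro iffI conjI; (elim exE conjE)?)
  fix \<phi> :: "'a \<Rightarrow>\<^sub>C real" assume "\<forall>x. \<phi> (F x) - \<phi> x = \<gamma> x"
  then have \<phi>: "\<And>x. \<phi> (F x) - \<phi> x = \<gamma> x" by blast
  note telescope = orbit_sum_telescope[of "apply_bcontfun \<phi>" F \<gamma>, OF \<phi>]
  have cont_\<phi>: "continuous_on UNIV \<phi>"
    using apply_bcontfun[of \<phi>] by (simp add: bcontfun_def)
  note contF = uniformly_stable_continuous_iterate[OF assms(2)]
  have cont_s: "continuous_on UNIV (orbit_sum F \<gamma> n)" for n
    unfolding telescope[abs_def]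
    by (intro continuous_on_diff cont_\<phi> continuous_on_compose2[OF cont_\<phi> contF]) auto
  \<comment> \<open>The sum of index 0 has the single term \<open>\<gamma>\<close>, so \<open>\<gamma>\<close> is itself one of the orbit sums.\<close>
  have "\<gamma> = orbit_sum F \<gamma> 0"
    by (simp add: orbit_sum_def fun_eq_iff)
  then show "\<gamma> \<in> bcontfun"
    using bcontfun_if_compact_UNIV[OF assms(1) cont_s] by metis
  have "\<bar>orbit_sum F \<gamma> n x\<bar> \<le> 2 * norm \<phi>" for n x
    using norm_bounded[of \<phi> "(F ^^ Suc n) x"] norm_bounded[of \<phi> x]
    unfolding telescope real_norm_def by linarith
  then show "bounded_in_C (range (orbit_sum F \<gamma>))"
    unfolding bounded_in_C_iff using bcontfun_if_compact_UNIV[OF assms(1) cont_s] by blast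
  show "equicontinuous (range (orbit_sum F \<gamma>))"
    by (rule equicontinuous_orbit_sums_of_coboundary[of F "apply_bcontfun \<phi>" \<gamma>,
          OF assms(2) compact_uniformly_continuous[OF cont_\<phi> assms(1)] \<phi>])
next
  assume "bounded_in_C (range (orbit_sum F \<gamma>))" and eq: "equicontinuous (range (orbit_sum F \<gamma>))"
  then obtain M where M: "\<And>n x. \<bar>orbit_sum F \<gamma> n x\<bar> \<le> M"
    unfolding bounded_in_C_iff by blast
  define \<phi> where "\<phi> x = - real_limsup (\<lambda>n. orbit_sum F \<gamma> n x)" for x
  have "\<phi> \<in> bcontfun"
    unfolding \<phi>_def
    by (intro bcontfun_if_compact_UNIV[OF assms(1)] continuous_on_minus continuous_real_limsup[OF M eq])
  moreover have "\<phi> (F x) - \<phi> x = \<gamma> x" for x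
    unfolding \<phi>_def by (simp add: real_limsup_orbit_sum_shift[OF M, of x])
  ultimately show "\<exists>\<phi> :: 'a \<Rightarrow>\<^sub>C real. \<forall>x. \<phi> (F x) - \<phi> x = \<gamma> x"
    by (intro exI[of _ "Bcontfun \<phi>"]) (simp add: Bcontfun_inverse)
qed

end
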